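(* Let $(X,Y)$ be a bivariate random vector satisfying the regularity and moment conditions stated in the context. Then the conditional curvature score of $Y$ satisfies $S_Y=0$ if and only if the conditional density of $Y$ given $X$ has the semiparametric GLM conditional form, i.e. there exist a function $b_Y:\mathring{\mathcal X}_Y\to(0,\infty)$ and a function $\eta:\mathring{\mathcal X}_X\to\mathbb R$ such that, for $P_X$-almost every $x$ and every $y\in\mathring{\mathcal X}_Y$, $$p(y\mid x)=b_Y(y)\exp\{y\,\eta(x)-A_Y(\eta(x))\},\qquad A_Y(t):=\log\int_{\mathcal X_Y}b_Y(u)e^{ut}\,d\nu_Y(u),$$ with $A_Y(\eta(x))$ finite.
   Context: Each of the two variables $Z\in\{X,Y\}$ is either continuous or count, and the two may be of different types. A continuous variable has support $\mathcal X_Z\subseteq\mathbb R$ a connected interval with nonempty interior and dominating measure $\nu_Z$ equal to Lebesgue measure; put $\mathring{\mathcal X}_Z=\operatorname{int}(\mathcal X_Z)$. A count variable has support $\mathcal X_Z$ a finite or countably infinite set of consecutive integers with at least three elements and $\nu_Z$ counting measure; put $\mathring{\mathcal X}_Z=\mathcal X_Z$. The vector $(X,Y)$ has law $P$ on $\mathcal X_X\times\mathcal X_Y$ with density $p=dP/d(\nu_X\otimes\nu_Y)$ ("density" includes probability mass functions); $P_X$ is the law of $X$ and $p(y\mid x)$ the conditional density of $Y$ given $X=x$. Regularity: $p$ is finite and strictly positive on $\mathring{\mathcal X}_X\times\mathring{\mathcal X}_Y$, and $\log p$ is jointly $C^2$ in the continuous coordinates for each fixed choice of the count coordinates. Coordinate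 operators: for a continuous coordinate $z$, $\mathcal D_Z^2f=\partial_z^2f$. For a count coordinate, $\mathcal D_Z^2f(z)=f(z+2)-2f(z+1)+f(z)$ (other coordinate fixed), defined only when $z,z+1,z+2\in\mathcal X_Z$. Admissible event: $\mathcal A_Y^{(2)}=\{Y,Y+1,Y+2\in\mathcal X_Y\}$ if $Y$ is count, and $\mathcal A_Y^{(2)}=\{Y\in\mathring{\mathcal X}_Y\}$ (probability one) if $Y$ is continuous. Curvature and conditional curvature score (CCS): $H_Y:=\mathcal D_Y^2\log p$ and $$S_Y:=\mathbb E\bigl[\operatorname{Var}\{H_Y(X,Y)\mid Y\}\bigr],$$ where both the outer expectation and the conditional variance are taken under $P(\,\cdot\mid\mathcal A_Y^{(2)})$. Moment condition: $H_Y\in L^2(P(\,\cdot\mid\mathcal A_Y^{(2)}))$. *)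

theory Defs
  imports "HOL-Probability.Probability"
begin

datatype var_kind = Continuous | Count

text \<open>Count variables take integer values, represented as real numbers.\<close>

definition valid_support :: "var_kind \<Rightarrow> real set \<Rightarrow> bool" where
  "valid_support k S \<longleftrightarrow>
    (case k of
      Continuous \<Rightarrow> is_interval S \<and> interior S \<noteq> {}
    | Count \<Rightarrow> (\<exists>K::int set. S = of_int ` K \<and> (\<forall>i\<in>K. \<forall>j\<in>K. {i..j} \<subseteq> K)
                 \<and> (infinite K \<or> card K \<ge> 3)))"

definition dominating_measure :: "var_kind \<Rightarrow> real set \<Rightarrow> real measure" where
  "dominating_measure k S =
    (case k of Continuous \<Rightarrow> restrict_space lborel S | Count \<Rightarrow> count_space S)"

definition support_interior :: "var_kind \<Rightarrow> real set \<Rightarrow> real set" where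
  "support_interior k S = (case k of Continuous \<Rightarrow> interior S | Count \<Rightarrow> S)"

text \<open>The event of admissibility of \<open>Z\<close> is that \<open>Z\<close> lies in this set.\<close>

definition admissible2 :: "var_kind \<Rightarrow> real set \<Rightarrow> real set" where
  "admissible2 k S =
    (case k of Continuous \<Rightarrow> interior S | Count \<Rightarrow> {z. z \<in> S \<and> z + 1 \<in> S \<and> z + 2 \<in> S})"

definition diff_op2 :: "var_kind \<Rightarrow> (real \<Rightarrow> real) \<Rightarrow> real \<Rightarrow> real" where
  "diff_op2 k f z =
    (case k of Continuous \<Rightarrow> deriv (deriv f) z | Count \<Rightarrow> f (z + 2) - 2 * f (z + 1) + f z)"

text \<open>Twice continuously (Frechet) differentiable on an open set.\<close>

definition C2_on :: "('a::real_normed_vector \<Rightarrow> real) \<Rightarrow> 'a set \<Rightarrow> bool" where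
  "C2_on f U \<longleftrightarrow>
    (\<exists>(f' :: 'a \<Rightarrow> 'a \<Rightarrow>\<^sub>L real) (f'' :: 'a \<Rightarrow> 'a \<Rightarrow>\<^sub>L ('a \<Rightarrow>\<^sub>L real)).
      (\<forall>z\<in>U. (f has_derivative blinfun_apply (f' z)) (at z)) \<and>
      (\<forall>z\<in>U. (f' has_derivative blinfun_apply (f'' z)) (at z)) \<and>
      continuous_on U f'')"

definition log_dens :: "(real \<times> real \<Rightarrow> ennreal) \<Rightarrow> real \<times> real \<Rightarrow> real" where
  "log_dens p z = ln (enn2real (p z))"

definition regular_density ::
    "var_kind \<Rightarrow> real set \<Rightarrow> var_kind \<Rightarrow> real set \<Rightarrow> (real \<times> real \<Rightarrow> ennreal) \<Rightarrow> bool" where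
  "regular_density kX SX kY SY p \<longleftrightarrow>
    (\<forall>x\<in>support_interior kX SX. \<forall>y\<in>support_interior kY SY. 0 < p (x, y) \<and> p (x, y) < \<infinity>) \<and>
    (case (kX, kY) of
      (Continuous, Continuous) \<Rightarrow> C2_on (log_dens p) (interior SX \<times> interior SY)
    | (Continuous, Count) \<Rightarrow> (\<forall>y\<in>SY. C2_on (\<lambda>x. log_dens p (x, y)) (interior SX))
    | (Count, Continuous) \<Rightarrow> (\<forall>x\<in>SX. C2_on (\<lambda>y. log_dens p (x, y)) (interior SY))
    | (Count, Count) \<Rightarrow> True)"

text \<open>The value 0 is used where the coordinate operator is not defined. Conditionally on
  admissibility of \<open>Y\<close> this happens only for \<open>x\<close> an end point of the support of a continuous \<open>X\<close>,
  so with probability zero.\<close>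

definition curvature ::
    "var_kind \<Rightarrow> real set \<Rightarrow> var_kind \<Rightarrow> real set \<Rightarrow> (real \<times> real \<Rightarrow> ennreal) \<Rightarrow> real \<Rightarrow> real \<Rightarrow> real" where
  "curvature kX SX kY SY p x y =
    (if x \<in> support_interior kX SX \<and> y \<in> admissible2 kY SY
     then diff_op2 kY (\<lambda>v. log_dens p (x, v)) y else 0)"

definition cond_variance :: "'a measure \<Rightarrow> 'a measure \<Rightarrow> ('a \<Rightarrow> real) \<Rightarrow> 'a \<Rightarrow> real" where
  "cond_variance Q F f = real_cond_exp Q F (\<lambda>\<omega>. (f \<omega> - real_cond_exp Q F f \<omega>)\<^sup>2)"

definition admissible_prob ::
    "'a measure \<Rightarrow> var_kind \<Rightarrow> real set \<Rightarrow> ('a \<Rightarrow> real) \<Rightarrow> 'a measure" where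
  "admissible_prob M k S Z = uniform_measure M {\<omega> \<in> space M. Z \<omega> \<in> admissible2 k S}"

definition cond_curvature_score ::
    "'a measure \<Rightarrow> var_kind \<Rightarrow> real set \<Rightarrow> var_kind \<Rightarrow> real set \<Rightarrow> (real \<times> real \<Rightarrow> ennreal) \<Rightarrow>
     ('a \<Rightarrow> real) \<Rightarrow> ('a \<Rightarrow> real) \<Rightarrow> real" where
  "cond_curvature_score M kX SX kY SY p X Y =
    (let Q = admissible_prob M kY SY Y in
      \<integral>\<omega>. cond_variance Q (vimage_algebra (space M) Y borel)
           (\<lambda>\<omega>. curvature kX SX kY SY p (X \<omega>) (Y \<omega>)) \<omega> \<partial>Q)"

definition square_integrable :: "'a measure \<Rightarrow> ('a \<Rightarrow> real) \<Rightarrow> bool" where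
  "square_integrable Q f \<longleftrightarrow> f \<in> borel_measurable Q \<and> integrable Q (\<lambda>\<omega>. (f \<omega>)\<^sup>2)"

definition cond_density ::
    "real measure \<Rightarrow> (real \<times> real \<Rightarrow> ennreal) \<Rightarrow> real \<Rightarrow> real \<Rightarrow> ennreal" where
  "cond_density \<nu> p x y = p (x, y) / (\<integral>\<^sup>+v. p (x, v) \<partial>\<nu>)"

definition ln_ereal :: "ennreal \<Rightarrow> ereal" where
  "ln_ereal c = (if c = 0 then -\<infinity> else if c = \<infinity> then \<infinity> else ereal (ln (enn2real c)))"

definition log_partition :: "real measure \<Rightarrow> (real \<Rightarrow> real) \<Rightarrow> real \<Rightarrow> ereal" where
  "log_partition \<nu> b t = ln_ereal (\<integral>\<^sup>+u. ennreal (b u * exp (u * t)) \<partial>\<nu>)"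

text \<open>Only the values of \<open>b\<close> on the interior of the support of \<open>Y\<close> and of \<open>\<eta>\<close> on that of the
  support of \<open>X\<close> matter: the remaining points form null sets.\<close>

definition glm_conditional_form ::
    "'a measure \<Rightarrow> var_kind \<Rightarrow> real set \<Rightarrow> var_kind \<Rightarrow> real set \<Rightarrow> (real \<times> real \<Rightarrow> ennreal) \<Rightarrow>
     ('a \<Rightarrow> real) \<Rightarrow> bool" where
  "glm_conditional_form M kX SX kY SY p X \<longleftrightarrow>
    (let \<nu>\<^sub>Y = dominating_measure kY SY in
      \<exists>(b :: real \<Rightarrow> real) (\<eta> :: real \<Rightarrow> real).
        (\<forall>y\<in>support_interior kY SY. 0 < b y) \<and>
        (AE x in distr M (dominating_measure kX SX) X.
          \<bar>log_partition \<nu>\<^sub>Y b (\<eta> x)\<bar> \<noteq> \<infinity> \<and>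
          (\<forall>y\<in>support_interior kY SY.
            cond_density \<nu>\<^sub>Y p x y =
              ennreal (b y * exp (y * \<eta> x - real_of_ereal (log_partition \<nu>\<^sub>Y b (\<eta> x)))))))"

end

theory Submission
  imports Defs
begin

text \<open>
  The score is \<open>E[(H - E[H|Y])\<^sup>2]\<close>, so it vanishes iff \<open>H(X,Y)\<close> is almost surely a function of \<open>Y\<close>.
  As the density is positive, Fubini and continuity of \<open>H\<close> in the continuous coordinates make
  \<open>H(x,y)\<close> independent of \<open>x\<close> at every point of the interior. Hence, for a fixed \<open>x\<^sub>0\<close>, the function
  \<open>y \<mapsto> log p(x,y) - log p(x\<^sub>0,y)\<close> is killed by the second-order operator and so is affine in \<open>y\<close>:
  this is the exponential form with base \<open>b = p(x\<^sub>0,\<cdot>)\<close>, and the normalisation is forced.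
  Conversely the exponential form makes \<open>log p(x,\<cdot>)\<close> equal to \<open>log b\<close> up to an affine function,
  so \<open>H(x,\<cdot>)\<close> is the same for almost every \<open>x\<close>.
\<close>

subsection \<open>Supports and dominating measures\<close>

lemma valid_support_measurable:
  assumes "valid_support k S"
  shows "S \<in> sets borel"
proof (cases k)
  case Continuous
  then show ?thesis using assms by (simp add: valid_support_def real_interval_borel_measurable)
next
  case Count
  then have "countable S" using assms by (auto simp: valid_support_def)
  then show ?thesis by (rule sets.countable[rotated]) auto
qed

lemma valid_support_countable: "valid_support Count S \<Longrightarrow> countable S"
  by (auto simp: valid_support_def)

lemma space_dominating_measure [simp]: "space (dominating_measure k S) = S"
  by (cases k) (auto simp: dominating_measure_def space_restrict_space)

text \<open>Every subset of a countable set of reals is Borel, so the power set carried by counting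
  measure is the trace of the Borel sets. Measurability can then be argued in the same way for both
  kinds of variable.\<close>

lemma sets_dominating_measure:
  assumes "valid_support k S"
  shows "sets (dominating_measure k S) = sets (restrict_space borel S)"
proof (cases k)
  case Continuous
  then show ?thesis by (simp add: dominating_measure_def sets_restrict_space)
next
  case Count
  with assms have "countable S" by (simp add: valid_support_countable)
  have "T \<in> sets (restrict_space borel S)" if "T \<subseteq> S" for T
  proof -
    have "T \<in> sets borel"
      using countable_subset[OF that \<open>countable S\<close>] by (rule sets.countable[rotated]) auto
    then show ?thesis using that by (auto simp: sets_restrict_space image_iff intro!: bexI[of _ T])
  qed
  moreover have "T \<subseteq> S" if "T \<in> sets (restrict_space borel S)" for T
    using that by (auto simp: sets_restrict_space)
  ultimately show ?thesis using Count by (auto simp: dominating_measure_def)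
qed

lemma sigma_finite_dominating_measure:
  assumes "valid_support k S"
  shows "sigma_finite_measure (dominating_measure k S)"
proof (cases k)
  case Continuous
  then show ?thesis
    using valid_support_measurable[OF assms]
    by (auto simp: dominating_measure_def
        intro!: sigma_finite_measure_restrict_space lborel.sigma_finite_measure_axioms)
next
  case Count
  then show ?thesis
    using valid_support_countable assms
    by (auto simp: dominating_measure_def intro!: sigma_finite_measure_count_space_countable)
qed

lemma measurable_ident_dominating_measure:
  assumes "valid_support k S"
  shows "(\<lambda>x. x) \<in> dominating_measure k S \<rightarrow>\<^sub>M borel"
  using measurable_restrict_space1[of "\<lambda>x. x" borel borel S]
  by (simp cong: measurable_cong_sets add: sets_dominating_measure[OF assms])

text \<open>A three-element subset \<open>T\<close> of \<open>K\<close> spans an interval of at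
  least three integers, and \<open>K\<close> contains that interval because it has no gaps. The
  triple starts at \<open>Min T\<close>.\<close>

lemma consecutive_integers_triple:
  fixes K :: "int set"
  assumes "\<forall>i\<in>K. \<forall>j\<in>K. {i..j} \<subseteq> K" and "infinite K \<or> card K \<ge> 3"
  obtains i where "i \<in> K" "i + 1 \<in> K" "i + 2 \<in> K"
proof -
  obtain T where T: "T \<subseteq> K" "card T = 3" "finite T"
    using assms(2)
    by (metis infinite_arbitrarily_large obtain_subset_with_card_n)
  then have "T \<noteq> {}" by auto
  have "T \<subseteq> {Min T..Max T}" using T by auto
  then have "card T \<le> card {Min T..Max T}" by (intro card_mono) auto
  then have "Min T + 2 \<le> Max T" using T by auto
  moreover have "{Min T..Max T} \<subseteq> K"
    using assms(1) T Min_in[OF T(3) \<open>T \<noteq> {}\<close>] Max_in[OF T(3) \<open>T \<noteq> {}\<close>] by blast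
  ultimately show ?thesis
    by (intro that[of "Min T"]) (auto simp: subset_iff)
qed

lemma admissible2_nonempty:
  assumes "valid_support k S"
  shows "admissible2 k S \<noteq> {}"
proof (cases k)
  case Continuous
  then show ?thesis using assms by (simp add: valid_support_def admissible2_def)
next
  case Count
  with assms obtain K :: "int set" where S: "S = of_int ` K"
    and K: "\<forall>i\<in>K. \<forall>j\<in>K. {i..j} \<subseteq> K" "infinite K \<or> card K \<ge> 3"
    by (auto simp: valid_support_def)
  obtain i where i: "i \<in> K" "i + 1 \<in> K" "i + 2 \<in> K"
    using consecutive_integers_triple[OF K] by blast
  have "real_of_int i \<in> admissible2 k S"
    using Count imageI[OF i(1), of real_of_int] imageI[OF i(2), of real_of_int]
      imageI[OF i(3), of real_of_int] by (simp add: admissible2_def S)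
  then show ?thesis by blast
qed

lemma admissible2_subset_interior: "admissible2 k S \<subseteq> support_interior k S"
  by (cases k) (auto simp: admissible2_def support_interior_def)

lemma support_interior_subset: "support_interior k S \<subseteq> S"
  by (cases k) (auto simp: support_interior_def interior_subset)

lemma admissible2_measurable:
  assumes "valid_support k S"
  shows "admissible2 k S \<in> sets borel"
proof (cases k)
  case Continuous
  then show ?thesis by (simp add: admissible2_def)
next
  case Count
  have "countable (admissible2 k S)"
    using Count valid_support_countable assms
    by (auto simp: admissible2_def intro: countable_subset)
  then show ?thesis by (rule sets.countable[rotated]) auto
qed

section \<open>Almost-everywhere statements on a support\<close>

lemma AE_dominating_measure_iff:
  assumes "valid_support k S"
  shows "(AE z in dominating_measure k S. P z) \<longleftrightarrow>
    (case k of Continuous \<Rightarrow> AE z in lborel. z \<in> S \<longrightarrow> P z | Count \<Rightarrow> \<forall>z\<in>S. P z)"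
  using valid_support_measurable[OF assms]
  by (cases k; simp only: dominating_measure_def var_kind.case)
    (simp_all add: AE_restrict_space_iff AE_count_space)

text \<open>At most the end points of an interval are lost: the frontier of a convex set is Lebesgue
  null.\<close>

lemma AE_support_interior:
  assumes "valid_support k S"
  shows "AE z in dominating_measure k S. z \<in> support_interior k S"
proof (cases k)
  case Continuous
  then have "convex S" using assms by (simp add: valid_support_def is_interval_convex)
  then have "negligible (frontier S)" by (rule negligible_convex_frontier)
  then have "frontier S \<in> null_sets lborel"
    by (metis borel_closed frontier_closed
        negligible_iff_null_sets null_sets_completion_iff sets_lborel)
  then have "AE z in lborel. z \<notin> frontier S" by (rule AE_not_in)
  then have "AE z in lborel. z \<in> S \<longrightarrow> z \<in> interior S"
    by eventually_elim (use closure_subset in \<open>auto simp: frontier_def\<close>)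
  then show ?thesis
    using Continuous by (simp add: AE_dominating_measure_iff[OF assms] support_interior_def)
next
  case Count
  then show ?thesis by (simp add: AE_dominating_measure_iff[OF assms] support_interior_def)
qed

text \<open>For a continuous variable the set where \<open>f\<close> and \<open>g\<close> differ is
  open and null, hence empty; for a count variable every point of the support has mass one.\<close>

lemma AE_eq_imp_eq_on_interior:
  assumes "valid_support k S"
    and ae: "AE z in dominating_measure k S. z \<in> support_interior k S \<longrightarrow> f z = g z"
    and f: "k = Continuous \<Longrightarrow> continuous_on (interior S) f"
    and g: "k = Continuous \<Longrightarrow> continuous_on (interior S) g"
    and z: "z \<in> support_interior k S"
  shows "f z = (g z :: real)"
proof (cases k)
  case Continuous
  define U where "U = {z \<in> interior S. f z - g z \<noteq> 0}"
  have "continuous_on (interior S) (\<lambda>z. f z - g z)"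
    using f g Continuous by (intro continuous_on_diff) auto
  then have "open U"
    using continuous_open_preimage[of "interior S" "\<lambda>z. f z - g z" "- {0}"]
    by (simp add: U_def vimage_def Int_def open_Compl)
  have "AE z in lborel. z \<in> S \<longrightarrow> z \<in> interior S \<longrightarrow> f z = g z"
    using ae Continuous by (simp add: AE_dominating_measure_iff[OF assms(1)] support_interior_def)
  \<comment> \<open>Phrased as almost every point of the open set \<open>U\<close> lying in the
    closed set \<open>{}\<close>, which forces every point of \<open>U\<close> into
    \<open>{}\<close>.\<close>
  then have "AE z in lborel. z \<in> U \<longrightarrow> z \<in> {}"
    by eventually_elim (use interior_subset in \<open>auto simp: U_def\<close>)
  then have "AE z in lebesgue. z \<in> U \<longrightarrow> z \<in> {}" by (rule AE_completion)
  then have "U = {}"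
    using mem_closed_if_AE_lebesgue_open[OF \<open>open U\<close> closed_empty] by blast
  then show ?thesis using z Continuous by (auto simp: U_def support_interior_def)
next
  case Count
  then show ?thesis
    using ae z by (auto simp: AE_dominating_measure_iff[OF assms(1)] support_interior_def)
qed

text \<open>The admissible set is nonempty and either open or made of atoms, so it is never null and
  must meet every set of full measure.\<close>

lemma AE_imp_ex_admissible2:
  assumes "valid_support k S" and ae: "AE z in dominating_measure k S. P z"
  shows "\<exists>z\<in>admissible2 k S. P z"
proof (rule ccontr)
  assume neg: "\<not> ?thesis"
  obtain z where z: "z \<in> admissible2 k S" using admissible2_nonempty[OF assms(1)] by blast
  show False
  proof (cases k)
    case Continuous
    \<comment> \<open>If \<open>P\<close> failed throughout the interior, almost no point would be
      interior, so the constants 0 and 1 would agree almost everywhere there, and hence at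
      \<open>z\<close>.\<close>
    have "AE z in dominating_measure k S. z \<in> support_interior k S \<longrightarrow> (0::real) = 1"
      using ae by eventually_elim (use neg Continuous in \<open>auto simp: support_interior_def admissible2_def\<close>)
    then show False
      using AE_eq_imp_eq_on_interior[OF assms(1), of "\<lambda>_. 0" "\<lambda>_. 1"]
        z admissible2_subset_interior by fastforce
  next
    case Count
    then show False using ae neg z
      by (auto simp: AE_dominating_measure_iff[OF assms(1)] admissible2_def)
  qed
qed

text \<open>A function continuous on the open interior stays Borel when extended by 0, the default
  value used in \<open>curvature\<close>. Under counting measure every function is
  measurable.\<close>

lemma borel_measurable_dominating_measure:
  fixes f :: "real \<Rightarrow> real"
  assumes "valid_support k S"
    and "k = Continuous \<Longrightarrow> continuous_on (interior S) f"
    and "\<And>z. k = Continuous \<Longrightarrow> z \<notin> interior S \<Longrightarrow> f z = 0"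
  shows "f \<in> borel_measurable (dominating_measure k S)"
proof (cases k)
  case Continuous
  have "(\<lambda>z. if z \<in> interior S then f z else 0) \<in> borel_measurable borel"
    using assms Continuous by (intro borel_measurable_continuous_on_if) auto
  also have "(\<lambda>z. if z \<in> interior S then f z else 0) = f" using assms(3) Continuous by auto
  finally show ?thesis
    using measurable_compose[OF measurable_ident_dominating_measure[OF assms(1)]] by blast
qed (simp add: dominating_measure_def)

subsection \<open>The second-order coordinate operator\<close>

text \<open>Imposes nothing on count variables, so that the rules for \<open>diff_op2\<close> can be
  stated once for both kinds. Explicit derivatives \<open>f'\<close> and \<open>f''\<close> are used
  because the algebraic differentiation rules apply to them directly.\<close>

definition twice_diff :: "var_kind \<Rightarrow> real set \<Rightarrow> (real \<Rightarrow> real) \<Rightarrow> bool" where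
  "twice_diff k S f \<longleftrightarrow> (k = Continuous \<longrightarrow>
    (\<exists>f' f''. \<forall>z\<in>interior S. (f has_real_derivative f' z) (at z) \<and> (f' has_real_derivative f'' z) (at z)))"

text \<open>Iterating \<open>deriv\<close> requires the first derivative near \<open>z\<close> and
  not only at \<open>z\<close>: on the open set \<open>U\<close> the function \<open>deriv f\<close>
  coincides with \<open>f'\<close>, and \<open>deriv\<close> depends only on values near the
  point.\<close>

lemma deriv_deriv_eq:
  assumes "open U" "z \<in> U" "\<And>z. z \<in> U \<Longrightarrow> (f has_real_derivative f' z) (at z)"
    and "(f' has_real_derivative d) (at z)"
  shows "deriv (deriv f) z = d"
proof -
  have "eventually (\<lambda>z. z \<in> U) (nhds z)" using assms by (intro eventually_nhds_in_open)
  then have "eventually (\<lambda>z. deriv f z = f' z) (nhds z)"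
    by eventually_elim (use assms in \<open>auto intro: DERIV_imp_deriv\<close>)
  then have "deriv (deriv f) z = deriv f' z" by (rule deriv_cong_ev) simp
  then show ?thesis using assms(4) by (simp add: DERIV_imp_deriv)
qed

text \<open>Agreement of \<open>h\<close> with the combination on the interior suffices: derivatives
  are local, and admissibility of a count value \<open>z\<close> puts \<open>z\<close>,
  \<open>z + 1\<close> and \<open>z + 2\<close> in the support. The case \<open>c = -1\<close>
  serves differences of log densities, the case \<open>c = 1\<close> the addition of an affine
  function.\<close>

lemma
  assumes f: "twice_diff k S f" and g: "twice_diff k S g"
    and h: "\<And>z. z \<in> support_interior k S \<Longrightarrow> h z = f z + c * g z"
  shows twice_diff_lincomb: "twice_diff k S h"
    and diff_op2_lincomb:
      "z \<in> admissible2 k S \<Longrightarrow> diff_op2 k h z = diff_op2 k f z + c * diff_op2 k g z"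
proof -
  have "twice_diff k S h \<and>
    (z \<in> admissible2 k S \<longrightarrow> diff_op2 k h z = diff_op2 k f z + c * diff_op2 k g z)"
  proof (cases k)
    case Continuous
    obtain f' f'' where f': "\<And>z. z \<in> interior S \<Longrightarrow> (f has_real_derivative f' z) (at z)"
      "\<And>z. z \<in> interior S \<Longrightarrow> (f' has_real_derivative f'' z) (at z)"
      using f Continuous by (auto simp: twice_diff_def)
    obtain g' g'' where g': "\<And>z. z \<in> interior S \<Longrightarrow> (g has_real_derivative g' z) (at z)"
      "\<And>z. z \<in> interior S \<Longrightarrow> (g' has_real_derivative g'' z) (at z)"
      using g Continuous by (auto simp: twice_diff_def)
    have h': "(h has_real_derivative f' z + c * g' z) (at z)" if "z \<in> interior S" for z
    proof (rule has_field_derivative_transform_within_open)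
      show "((\<lambda>z. f z + c * g z) has_real_derivative f' z + c * g' z) (at z)"
        using f'(1)[OF that] g'(1)[OF that] by (intro DERIV_add DERIV_cmult)
    qed (use that h Continuous in \<open>auto simp: support_interior_def\<close>)
    have h'': "((\<lambda>z. f' z + c * g' z) has_real_derivative f'' z + c * g'' z) (at z)"
      if "z \<in> interior S" for z
      using f'(2)[OF that] g'(2)[OF that] by (intro DERIV_add DERIV_cmult)
    have "diff_op2 k h z = diff_op2 k f z + c * diff_op2 k g z" if "z \<in> admissible2 k S"
    proof -
      have z: "z \<in> interior S" using that Continuous by (simp add: admissible2_def)
      show ?thesis
        using deriv_deriv_eq[OF open_interior z h' h''[OF z]]
          deriv_deriv_eq[OF open_interior z f'(1) f'(2)[OF z]]
          deriv_deriv_eq[OF open_interior z g'(1) g'(2)[OF z]]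
        by (simp add: diff_op2_def Continuous)
    qed
    moreover have "twice_diff k S h"
      unfolding twice_diff_def
      by (intro impI exI[of _ "\<lambda>z. f' z + c * g' z"] exI[of _ "\<lambda>z. f'' z + c * g'' z"]
          ballI conjI h' h'')
    ultimately show ?thesis by blast
  next
    case Count
    then show ?thesis
      using h by (auto simp: twice_diff_def diff_op2_def admissible2_def support_interior_def algebra_simps)
  qed
  then show "twice_diff k S h"
    "z \<in> admissible2 k S \<Longrightarrow> diff_op2 k h z = diff_op2 k f z + c * diff_op2 k g z" by auto
qed

lemma
  shows twice_diff_affine: "twice_diff k S (\<lambda>z. a + c * z)"
    and diff_op2_affine: "diff_op2 k (\<lambda>z. a + c * z) z = 0"
proof -
  have 1: "((\<lambda>z. a + c * z) has_real_derivative c) (at z)" for z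
    by (auto intro!: derivative_eq_intros)
  have 2: "((\<lambda>z. c) has_real_derivative 0) (at z)" for z by simp
  show "twice_diff k S (\<lambda>z. a + c * z)"
    unfolding twice_diff_def
    by (intro impI exI[of _ "\<lambda>_. c"] exI[of _ "\<lambda>_. 0"] ballI conjI 1 2)
  show "diff_op2 k (\<lambda>z. a + c * z) z = 0"
    using deriv_deriv_eq[OF open_UNIV UNIV_I 1 2]
    by (cases k) (auto simp: diff_op2_def algebra_simps)
qed

text \<open>Two consecutive zeros spread upwards and downwards along the recurrence; since
  \<open>K\<close> has no gaps, all intermediate triples stay inside it.\<close>

lemma second_difference_zero_imp_zero:
  fixes g :: "int \<Rightarrow> real"
  assumes K: "\<And>i j. i \<in> K \<Longrightarrow> j \<in> K \<Longrightarrow> {i..j} \<subseteq> K"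
    and rec: "\<And>j. j \<in> K \<Longrightarrow> j + 1 \<in> K \<Longrightarrow> j + 2 \<in> K \<Longrightarrow> g (j + 2) - 2 * g (j + 1) + g j = 0"
    and i: "i \<in> K" "i + 1 \<in> K" "g i = 0" "g (i + 1) = 0"
    and j: "j \<in> K"
  shows "g j = 0"
proof -
  have up: "i + int n \<in> K \<longrightarrow> g (i + int n) = 0" for n
  proof (induction n rule: less_induct)
    case (less n)
    consider "n = 0" | "n = 1" | m where "n = m + 2"
      by (metis One_nat_def Suc_1 add.commute add_Suc_right less_2_cases not_less nat_le_iff_add)
    then show ?case
    proof cases
      case (3 m)
      show ?thesis
      proof
        assume n: "i + int n \<in> K"
        have "{i..i + int n} \<subseteq> K" using K i(1) n by blast
        then have m: "i + int m \<in> K" "i + int m + 1 \<in> K" "i + int m + 2 \<in> K"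
          using 3 by (auto simp: subset_iff)
        then show "g (i + int n) = 0"
          using rec[OF m] less.IH[of m] less.IH[of "m + 1"] 3 by (simp add: algebra_simps)
      qed
    qed (use i in auto)
  qed
  \<comment> \<open>Counting down from \<open>i + 1\<close> makes \<open>n = 0\<close> and
    \<open>n = 1\<close> the two known zeros. The recurrence is read at \<open>i + 1 - int n\<close>
    and solved for its lowest term.\<close>
  have down: "i + 1 - int n \<in> K \<longrightarrow> g (i + 1 - int n) = 0" for n
  proof (induction n rule: less_induct)
    case (less n)
    consider "n = 0" | "n = 1" | m where "n = m + 2"
      by (metis One_nat_def Suc_1 add.commute add_Suc_right less_2_cases not_less nat_le_iff_add)
    then show ?case
    proof cases
      case (3 m)
      show ?thesis
      proof
        assume n: "i + 1 - int n \<in> K"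
        have "{i + 1 - int n..i + 1} \<subseteq> K" using K i(2) n by blast
        then have m: "i + 1 - int n \<in> K" "i + 1 - int n + 1 \<in> K" "i + 1 - int n + 2 \<in> K"
          using 3 by (auto simp: subset_iff)
        then show "g (i + 1 - int n) = 0"
          using rec[OF m] less.IH[of m] less.IH[of "m + 1"] 3 by (simp add: algebra_simps)
      qed
    qed (use i in auto)
  qed
  show ?thesis
    using up[of "nat (j - i)"] down[of "nat (i + 1 - j)"] j by (cases "i \<le> j") auto
qed

text \<open>On an interval, a zero second derivative makes \<open>f'\<close> a constant
  \<open>c\<close>, and then \<open>f z - c * z\<close> is constant. On consecutive integers,
  subtracting a suitable line leaves two adjacent zeros, which propagate.\<close>

lemma diff_op2_zero_imp_affine:
  assumes S: "valid_support k S" and f: "twice_diff k S f"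
    and zero: "\<And>z. z \<in> admissible2 k S \<Longrightarrow> diff_op2 k f z = 0"
  shows "\<exists>a c. \<forall>z\<in>support_interior k S. f z = a + c * z"
proof (cases k)
  case Continuous
  obtain f' f'' where f': "\<And>z. z \<in> interior S \<Longrightarrow> (f has_real_derivative f' z) (at z)"
    "\<And>z. z \<in> interior S \<Longrightarrow> (f' has_real_derivative f'' z) (at z)"
    using f Continuous by (auto simp: twice_diff_def)
  have "convex (interior S)"
    using S Continuous by (simp add: valid_support_def is_interval_convex convex_interior)
  have "f'' z = 0" if "z \<in> interior S" for z
    using deriv_deriv_eq[OF open_interior that f'(1) f'(2)[OF that]] zero[of z] that Continuous
    by (simp add: diff_op2_def admissible2_def)
  then have "\<exists>c. \<forall>z\<in>interior S. f' z = c"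
    using f'(2) by (intro has_field_derivative_zero_constant \<open>convex (interior S)\<close>)
      (metis DERIV_subset subset_UNIV)
  then obtain c where c: "\<And>z. z \<in> interior S \<Longrightarrow> f' z = c" by blast
  have "((\<lambda>z. f z - c * z) has_real_derivative 0) (at z within interior S)"
    if "z \<in> interior S" for z
    using f'(1)[OF that] c[OF that]
    by (auto intro!: derivative_eq_intros intro: DERIV_subset)
  then obtain a where "\<forall>z\<in>interior S. f z - c * z = a"
    using has_field_derivative_zero_constant[OF \<open>convex (interior S)\<close>] by blast
  then have "\<forall>z\<in>interior S. f z = a + c * z" by (simp add: algebra_simps)
  then show ?thesis using Continuous by (auto simp: support_interior_def)
next
  case Count
  obtain K :: "int set" where K: "S = of_int ` K" "\<forall>i\<in>K. \<forall>j\<in>K. {i..j} \<subseteq> K"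
    "infinite K \<or> card K \<ge> 3"
    using S Count by (auto simp: valid_support_def)
  obtain i where i: "i \<in> K" "i + 1 \<in> K" using consecutive_integers_triple[OF K(2,3)] by blast
  \<comment> \<open>Slope and intercept of the line through the values at \<open>i\<close> and
    \<open>i + 1\<close>, so that \<open>g\<close> vanishes at both points while keeping the second
    differences of \<open>f\<close>.\<close>
  define c where "c = f (of_int (i + 1)) - f (of_int i)"
  define a where "a = f (of_int i) - c * of_int i"
  define g where "g j = f (of_int j) - (a + c * of_int j)" for j
  have "g j = 0" if "j \<in> K" for j
  proof (rule second_difference_zero_imp_zero[of K g i])
    fix j assume j: "j \<in> K" "j + 1 \<in> K" "j + 2 \<in> K"
    have "real_of_int j \<in> admissible2 k S"
      using Count imageI[OF j(1), of real_of_int] imageI[OF j(2), of real_of_int]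
        imageI[OF j(3), of real_of_int] by (simp add: admissible2_def K(1))
    from zero[OF this] show "g (j + 2) - 2 * g (j + 1) + g j = 0"
      by (simp add: g_def diff_op2_def Count algebra_simps)
  qed (use K i that in \<open>auto simp: g_def a_def c_def algebra_simps\<close>)
  then have "\<forall>z\<in>S. f z = a + c * z" using K(1) by (auto simp: g_def)
  then show ?thesis using Count by (auto simp: support_interior_def)
qed

text \<open>The functions are the first and second derivatives applied to the fixed direction
  \<open>e\<close>. Curves with velocity \<open>e\<close> let one statement cover vertical lines in
  the plane, with \<open>e = (0, 1)\<close>, and the identity on the real line, with
  \<open>e = 1\<close>.\<close>

lemma C2_on_directional:
  fixes f :: "'a::real_normed_vector \<Rightarrow> real"
  assumes "C2_on f U"
  obtains D1 D2 where
    "\<And>\<gamma> v. (\<gamma> has_vector_derivative e) (at v) \<Longrightarrow> \<gamma> v \<in> U \<Longrightarrow>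
      ((\<lambda>t. f (\<gamma> t)) has_real_derivative D1 (\<gamma> v)) (at v)"
    "\<And>\<gamma> v. (\<gamma> has_vector_derivative e) (at v) \<Longrightarrow> \<gamma> v \<in> U \<Longrightarrow>
      ((\<lambda>t. D1 (\<gamma> t)) has_real_derivative D2 (\<gamma> v)) (at v)"
    "continuous_on U D2"
proof -
  obtain f' :: "'a \<Rightarrow> 'a \<Rightarrow>\<^sub>L real" and f'' :: "'a \<Rightarrow> 'a \<Rightarrow>\<^sub>L ('a \<Rightarrow>\<^sub>L real)" where
    f': "\<And>z. z \<in> U \<Longrightarrow> (f has_derivative blinfun_apply (f' z)) (at z)" and
    f'': "\<And>z. z \<in> U \<Longrightarrow> (f' has_derivative blinfun_apply (f'' z)) (at z)" and
    cont: "continuous_on U f''"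
    using assms unfolding C2_on_def by blast
  show ?thesis
  proof (rule that[of "\<lambda>z. f' z e" "\<lambda>z. f'' z e e"])
    fix \<gamma> v assume \<gamma>: "(\<gamma> has_vector_derivative e) (at v)" "\<gamma> v \<in> U"
    have 1: "(\<gamma> has_derivative (\<lambda>t. t *\<^sub>R e)) (at v)"
      using \<gamma>(1) by (simp add: has_vector_derivative_def)
    have "((\<lambda>t. f (\<gamma> t)) has_derivative (\<lambda>t. f' (\<gamma> v) (t *\<^sub>R e))) (at v)"
      using has_derivative_compose[OF 1 f'[OF \<gamma>(2)]] .
    then show "((\<lambda>t. f (\<gamma> t)) has_real_derivative f' (\<gamma> v) e) (at v)"
      by (simp add: has_field_derivative_def blinfun.scaleR_right mult.commute[of _ "f' (\<gamma> v) e"])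
    have "((\<lambda>z. f' z e) has_derivative (\<lambda>h. f'' (\<gamma> v) h e)) (at (\<gamma> v))"
      using f''[OF \<gamma>(2)] by (auto intro!: derivative_eq_intros simp: blinfun.zero_right)
    from has_derivative_compose[OF 1 this]
    show "((\<lambda>t. f' (\<gamma> t) e) has_real_derivative f'' (\<gamma> v) e e) (at v)"
      by (simp add: has_field_derivative_def blinfun.scaleR_right blinfun.scaleR_left
          mult.commute[of _ "f'' (\<gamma> v) e e"])
  next
    show "continuous_on U (\<lambda>z. f'' z e e)" by (intro continuous_intros cont)
  qed
qed

lemma C2_on_imp_continuous_on: "C2_on f U \<Longrightarrow> continuous_on U f"
  unfolding C2_on_def
  by (meson continuous_at_imp_continuous_on has_derivative_continuous)

subsection \<open>Vanishing conditional variance\<close>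

text \<open>The sets of the generated sigma-algebra are preimages under \<open>Y\<close>, so
  indicators factor through \<open>Y\<close>; multiples, sums and increasing limits inherit the
  factorisation.\<close>

lemma Doob_Dynkin_ennreal:
  fixes f :: "'a \<Rightarrow> ennreal"
  assumes Y: "Y \<in> X \<rightarrow> space N" and f: "f \<in> borel_measurable (vimage_algebra X Y N)"
  shows "\<exists>g\<in>borel_measurable N. \<forall>x\<in>X. f x = g (Y x)"
  using f
proof (induction rule: borel_measurable_induct)
  case (cong f g)
  then show ?case by simp
next
  case (set A)
  then obtain B where "B \<in> sets N" "A = Y -` B \<inter> X"
    by (auto simp: sets_vimage_algebra2[OF Y])
  then show ?case
    by (intro bexI[of _ "indicator B"]) (auto simp: indicator_def)
next
  case (mult u c)
  then obtain g where "g \<in> borel_measurable N" "\<forall>x\<in>X. u x = g (Y x)" by blast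
  then show ?case by (intro bexI[of _ "\<lambda>y. c * g y"]) auto
next
  case (add u v)
  then obtain g h where "g \<in> borel_measurable N" "\<forall>x\<in>X. u x = g (Y x)"
    "h \<in> borel_measurable N" "\<forall>x\<in>X. v x = h (Y x)" by blast
  then show ?case by (intro bexI[of _ "\<lambda>y. h y + g y"]) auto
next
  case (seq U)
  then have "\<forall>i. \<exists>g. g \<in> borel_measurable N \<and> (\<forall>x\<in>X. U i x = g (Y x))" by blast
  then obtain g where g: "\<And>i. g i \<in> borel_measurable N" "\<And>i x. x \<in> X \<Longrightarrow> U i x = g i (Y x)"
    by metis
  \<comment> \<open>A supremum in \<open>ennreal\<close> exists even off the range of
    \<open>Y\<close>, where the sequence \<open>g i\<close> need not increase.\<close>
  have "(\<lambda>y. SUP i. g i y) \<in> borel_measurable N" using g(1) by measurable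
  then show ?case
    by (rule bexI[rotated]) (use g(2) in \<open>auto simp: image_comp\<close>)
qed

text \<open>Since \<open>ennreal\<close> sends negative numbers to 0, \<open>ennreal (f x)\<close>
  and \<open>ennreal (- f x)\<close> are the positive and negative parts of \<open>f\<close>, and
  each is factored separately.\<close>

lemma Doob_Dynkin_real:
  fixes f :: "'a \<Rightarrow> real"
  assumes Y: "Y \<in> X \<rightarrow> space N" and f: "f \<in> borel_measurable (vimage_algebra X Y N)"
  shows "\<exists>g\<in>borel_measurable N. \<forall>x\<in>X. f x = g (Y x)"
proof -
  obtain g where g: "g \<in> borel_measurable N" "\<And>x. x \<in> X \<Longrightarrow> ennreal (f x) = g (Y x)"
    using Doob_Dynkin_ennreal[OF Y, of "\<lambda>x. ennreal (f x)"] f by auto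
  obtain h where h: "h \<in> borel_measurable N" "\<And>x. x \<in> X \<Longrightarrow> ennreal (- f x) = h (Y x)"
    using Doob_Dynkin_ennreal[OF Y, of "\<lambda>x. ennreal (- f x)"] f by auto
  have "f x = enn2real (g (Y x)) - enn2real (h (Y x))" if "x \<in> X" for x
    using g(2)[OF that, symmetric] h(2)[OF that, symmetric]
    by (cases "f x \<ge> 0") (auto simp: ennreal_neg)
  then show ?thesis
    using g(1) h(1) by (intro bexI[of _ "\<lambda>y. enn2real (g y) - enn2real (h y)"]) auto
qed

text \<open>By the tower property the integral equals the mean square distance from \<open>h\<close>
  to its conditional expectation. It vanishes iff \<open>h\<close> is almost surely its own
  conditional expectation, that is, almost surely \<open>F\<close>-measurable.\<close>

lemma integral_cond_variance_eq_0_iff: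
  assumes "prob_space Q" and F: "subalgebra Q F" and h: "square_integrable Q h"
  shows "(\<integral>\<omega>. cond_variance Q F h \<omega> \<partial>Q) = 0 \<longleftrightarrow>
    (\<exists>f\<in>borel_measurable F. AE \<omega> in Q. h \<omega> = f \<omega>)"
proof -
  interpret prob_space Q by fact
  interpret finite_measure_subalgebra Q F by unfold_locales fact
  have [measurable]: "h \<in> borel_measurable Q" and h2: "integrable Q (\<lambda>\<omega>. (h \<omega>)\<^sup>2)"
    using h by (auto simp: square_integrable_def)
  have int_h: "integrable Q h" using square_integrable_imp_integrable[OF _ h2] by simp
  let ?E = "real_cond_exp Q F h"
  have sq_int: "integrable Q (\<lambda>\<omega>. (h \<omega> - ?E \<omega>)\<^sup>2)"
  proof -
    \<comment> \<open>Conditional Jensen for the square makes the conditional expectation square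
      integrable, so the squared deviation is integrable and the tower property applies to
      it.\<close>
    have "AE \<omega> in Q. (?E \<omega>)\<^sup>2 \<le> real_cond_exp Q F (\<lambda>\<omega>. (h \<omega>)\<^sup>2) \<omega>"
      using real_cond_exp_jensens_inequality(2)[of h UNIV _ _ "\<lambda>x. x\<^sup>2"] int_h h2
        convex_power2 by simp
    moreover have "integrable Q (real_cond_exp Q F (\<lambda>\<omega>. (h \<omega>)\<^sup>2))" using h2 by auto
    ultimately have E2: "integrable Q (\<lambda>\<omega>. (?E \<omega>)\<^sup>2)"
      by (rule_tac Bochner_Integration.integrable_bound) (auto elim!: eventually_mono)
    have "integrable Q (\<lambda>\<omega>. 2 * (h \<omega>)\<^sup>2 + 2 * (?E \<omega>)\<^sup>2)" using h2 E2 by auto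
    moreover have "(a - b)\<^sup>2 \<le> 2 * a\<^sup>2 + 2 * b\<^sup>2" for a b :: real
      using zero_le_power2[of "a + b"] by (simp add: power2_eq_square algebra_simps)
    ultimately show ?thesis by (rule_tac Bochner_Integration.integrable_bound) auto
  qed
  have "(\<integral>\<omega>. cond_variance Q F h \<omega> \<partial>Q) = (\<integral>\<omega>. (h \<omega> - ?E \<omega>)\<^sup>2 \<partial>Q)"
    unfolding cond_variance_def using sq_int by (rule real_cond_exp_int(2))
  also have "\<dots> = 0 \<longleftrightarrow> (AE \<omega> in Q. h \<omega> = ?E \<omega>)"
    using sq_int by (subst integral_nonneg_eq_0_iff_AE) auto
  also have "\<dots> \<longleftrightarrow> (\<exists>f\<in>borel_measurable F. AE \<omega> in Q. h \<omega> = f \<omega>)"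
  proof
    assume "AE \<omega> in Q. h \<omega> = ?E \<omega>"
    then show "\<exists>f\<in>borel_measurable F. AE \<omega> in Q. h \<omega> = f \<omega>" by (intro bexI) auto
  next
    assume "\<exists>f\<in>borel_measurable F. AE \<omega> in Q. h \<omega> = f \<omega>"
    then obtain f where f: "f \<in> borel_measurable F" "AE \<omega> in Q. h \<omega> = f \<omega>" by blast
    have fQ: "f \<in> borel_measurable Q" by (rule measurable_from_subalg[OF F f(1)])
    \<comment> \<open>Integrability passes from \<open>h\<close> to its \<open>F\<close>-measurable
      version \<open>f\<close>, which conditional expectation then leaves fixed.\<close>
    have "integrable Q f" using integrable_cong_AE[THEN iffD1, OF _ fQ f(2) int_h] by simp
    then have "AE \<omega> in Q. real_cond_exp Q F f \<omega> = f \<omega>" using f(1) by (rule real_cond_exp_F_meas)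
    moreover have "AE \<omega> in Q. ?E \<omega> = real_cond_exp Q F f \<omega>"
      using f(2) fQ by (intro real_cond_exp_cong) auto
    ultimately show "AE \<omega> in Q. h \<omega> = ?E \<omega>" using f(2) by eventually_elim simp
  qed
  finally show ?thesis .
qed

subsection \<open>Regularity of the curvature\<close>

locale regular_pair = prob_space M for M :: "'a measure" +
  fixes kX kY :: var_kind and SX SY :: "real set"
    and p :: "real \<times> real \<Rightarrow> ennreal" and X Y :: "'a \<Rightarrow> real"
  assumes validX: "valid_support kX SX" and validY: "valid_support kY SY"
    and joint: "distributed M (dominating_measure kX SX \<Otimes>\<^sub>M dominating_measure kY SY)
      (\<lambda>\<omega>. (X \<omega>, Y \<omega>)) p"
    and regular: "regular_density kX SX kY SY p"
begin

abbreviation "\<nu>\<^sub>X \<equiv> dominating_measure kX SX"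
abbreviation "\<nu>\<^sub>Y \<equiv> dominating_measure kY SY"
abbreviation "I\<^sub>X \<equiv> support_interior kX SX"
abbreviation "I\<^sub>Y \<equiv> support_interior kY SY"
abbreviation "A\<^sub>Y \<equiv> admissible2 kY SY"
abbreviation "L x y \<equiv> log_dens p (x, y)"
abbreviation "H \<equiv> curvature kX SX kY SY p"

lemma density_pos:
  assumes "x \<in> I\<^sub>X" "y \<in> I\<^sub>Y"
  shows "0 < p (x, y)" "p (x, y) < \<infinity>"
  using regular assms by (auto simp: regular_density_def)

lemma density_eq_exp:
  assumes "x \<in> I\<^sub>X" "y \<in> I\<^sub>Y"
  shows "p (x, y) = ennreal (exp (L x y))"
  using density_pos[OF assms] by (simp add: log_dens_def enn2real_positive_iff)

lemma curvature_eq: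
  assumes "x \<in> I\<^sub>X" "y \<in> A\<^sub>Y"
  shows "H x y = diff_op2 kY (L x) y"
  using assms by (simp add: curvature_def)

text \<open>On the open rectangle the curvature is the second directional derivative of the log
  density along \<open>(0, 1)\<close>, which is jointly continuous by the C2 assumption.\<close>

lemma curvature_joint_continuous:
  assumes "kX = Continuous" "kY = Continuous"
  shows "continuous_on (interior SX \<times> interior SY) (\<lambda>z. H (fst z) (snd z))"
    and "x \<in> interior SX \<Longrightarrow> twice_diff kY SY (L x)"
proof -
  have C2: "C2_on (log_dens p) (interior SX \<times> interior SY)"
    using regular assms by (simp add: regular_density_def)
  have vert: "((\<lambda>t. (x, t)) has_vector_derivative (0, 1)) (at v)" for x v :: real
    by (auto intro!: derivative_eq_intros)
  obtain D1 D2 where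
    D1: "\<And>\<gamma> v. (\<gamma> has_vector_derivative (0, 1)) (at v) \<Longrightarrow> \<gamma> v \<in> interior SX \<times> interior SY \<Longrightarrow>
      ((\<lambda>t. log_dens p (\<gamma> t)) has_real_derivative D1 (\<gamma> v)) (at v)" and
    D2: "\<And>\<gamma> v. (\<gamma> has_vector_derivative (0, 1)) (at v) \<Longrightarrow> \<gamma> v \<in> interior SX \<times> interior SY \<Longrightarrow>
      ((\<lambda>t. D1 (\<gamma> t)) has_real_derivative D2 (\<gamma> v)) (at v)" and
    cont: "continuous_on (interior SX \<times> interior SY) D2"
    using C2_on_directional[OF C2] by metis
  have L': "(L x has_real_derivative D1 (x, v)) (at v)"
    "((\<lambda>t. D1 (x, t)) has_real_derivative D2 (x, v)) (at v)"
    if "x \<in> interior SX" "v \<in> interior SY" for x v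
    using D1[OF vert, of x v] D2[OF vert, of x v] that by auto
  show "twice_diff kY SY (L x)" if "x \<in> interior SX"
    unfolding twice_diff_def
    by (intro impI exI[of _ "\<lambda>v. D1 (x, v)"] exI[of _ "\<lambda>v. D2 (x, v)"] ballI conjI L' that)
  have "H (fst z) (snd z) = D2 z" if U: "z \<in> interior SX \<times> interior SY" for z
  proof -
    obtain x y where z: "z = (x, y)" "x \<in> interior SX" "y \<in> interior SY"
      using U by (cases z) auto
    have "deriv (deriv (L x)) y = D2 (x, y)"
      by (rule deriv_deriv_eq[OF open_interior z(3) L'(1)[OF z(2)] L'(2)[OF z(2,3)]])
    then show ?thesis
      using z assms by (simp add: curvature_def support_interior_def admissible2_def diff_op2_def)
  qed
  then show "continuous_on (interior SX \<times> interior SY) (\<lambda>z. H (fst z) (snd z))"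
    using cont by (simp cong: continuous_on_cong)
qed

lemma count_section:
  assumes "kX = Count" "kY = Continuous" "x \<in> SX"
  shows "continuous_on (interior SY) (H x)" and "twice_diff kY SY (L x)"
proof -
  have C2: "C2_on (L x) (interior SY)"
    using regular assms by (simp add: regular_density_def)
  have id: "((\<lambda>t. t) has_vector_derivative 1) (at v)" for v :: real
    by (auto intro!: derivative_eq_intros)
  obtain D1 D2 where
    D1: "\<And>\<gamma> v. (\<gamma> has_vector_derivative 1) (at v) \<Longrightarrow> \<gamma> v \<in> interior SY \<Longrightarrow>
      ((\<lambda>t. L x (\<gamma> t)) has_real_derivative D1 (\<gamma> v)) (at v)" and
    D2: "\<And>\<gamma> v. (\<gamma> has_vector_derivative 1) (at v) \<Longrightarrow> \<gamma> v \<in> interior SY \<Longrightarrow>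
      ((\<lambda>t. D1 (\<gamma> t)) has_real_derivative D2 (\<gamma> v)) (at v)" and
    cont: "continuous_on (interior SY) D2"
    using C2_on_directional[OF C2] by metis
  note L' = D1[OF id] D2[OF id]
  show "twice_diff kY SY (L x)"
    unfolding twice_diff_def
    by (intro impI exI[of _ D1] exI[of _ D2] ballI conjI L')
  have "H x y = D2 y" if "y \<in> interior SY" for y
    using deriv_deriv_eq[OF open_interior that L'(1) L'(2)[OF that]] that assms
    by (simp add: curvature_def support_interior_def admissible2_def diff_op2_def)
  then show "continuous_on (interior SY) (H x)"
    using cont by (simp cong: continuous_on_cong)
qed

lemma twice_diff_log_dens:
  assumes "x \<in> I\<^sub>X"
  shows "twice_diff kY SY (L x)"
proof (cases kY)
  case Continuous
  then show ?thesis
    using assms curvature_joint_continuous(2) count_section(2)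
    by (cases kX) (auto simp: support_interior_def)
qed (simp add: twice_diff_def)

lemma curvature_continuous_snd:
  assumes "kY = Continuous"
  shows "continuous_on (interior SY) (H x)"
proof (cases "x \<in> I\<^sub>X")
  case True
  show ?thesis
  proof (cases kX)
    case Continuous
    then have "continuous_on (interior SY) ((\<lambda>z. H (fst z) (snd z)) \<circ> Pair x)"
      using curvature_joint_continuous(1)[OF Continuous assms] True
      by (intro continuous_on_compose continuous_intros)
        (auto simp: support_interior_def elim!: continuous_on_subset)
    then show ?thesis by (simp add: o_def)
  qed (use True count_section(1) assms in \<open>auto simp: support_interior_def\<close>)
qed (simp add: curvature_def)

text \<open>Serves to extend equalities from almost every to every interior \<open>x\<close>. For a
  count \<open>Y\<close> the curvature is a combination of three sections of the log density, each
  continuous in \<open>x\<close>.\<close>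

lemma curvature_continuous_fst:
  assumes "kX = Continuous"
  shows "continuous_on (interior SX) (\<lambda>x. H x y)"
proof (cases "y \<in> A\<^sub>Y")
  case True
  show ?thesis
  proof (cases kY)
    case Continuous
    have "continuous_on (interior SX) ((\<lambda>z. H (fst z) (snd z)) \<circ> (\<lambda>x. (x, y)))"
      using curvature_joint_continuous(1)[OF assms Continuous] True Continuous
      by (intro continuous_on_compose continuous_intros)
        (auto simp: admissible2_def elim!: continuous_on_subset)
    then show ?thesis by (simp add: o_def)
  next
    case Count
    then have C: "continuous_on (interior SX) (\<lambda>x. L x v)" if "v \<in> SY" for v
      using regular assms that by (intro C2_on_imp_continuous_on) (auto simp: regular_density_def)
    have "continuous_on (interior SX) (\<lambda>x. L x (y + 2) - 2 * L x (y + 1) + L x y)"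
      using True Count by (intro continuous_intros C) (auto simp: admissible2_def)
    moreover have "H x y = L x (y + 2) - 2 * L x (y + 1) + L x y" if "x \<in> interior SX" for x
      using that True Count assms
      by (simp add: curvature_def support_interior_def diff_op2_def)
    ultimately show ?thesis by (simp cong: continuous_on_cong)
  qed
qed (simp add: curvature_def)

lemma curvature_measurable_snd: "H x \<in> borel_measurable \<nu>\<^sub>Y"
  using validY curvature_continuous_snd
  by (rule borel_measurable_dominating_measure) (auto simp: curvature_def admissible2_def)

lemma curvature_measurable_fst: "(\<lambda>x. H x y) \<in> borel_measurable \<nu>\<^sub>X"
  using validX curvature_continuous_fst
  by (rule borel_measurable_dominating_measure) (auto simp: curvature_def support_interior_def)

text \<open>If one coordinate is countable, measurability of the sections suffices. If both are
  continuous, the curvature is continuous on an open rectangle and 0 outside.\<close>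

lemma curvature_measurable:
  "(\<lambda>z. H (fst z) (snd z)) \<in> borel_measurable (\<nu>\<^sub>X \<Otimes>\<^sub>M \<nu>\<^sub>Y)"
proof -
  consider "kX = Count" | "kY = Count" | "kX = Continuous" "kY = Continuous"
    by (metis var_kind.exhaust)
  then show ?thesis
  proof cases
    case 1
    then have "(\<lambda>z. H (fst z) (snd z)) \<in> borel_measurable (count_space SX \<Otimes>\<^sub>M \<nu>\<^sub>Y)"
      using validX curvature_measurable_snd
      by (intro measurable_pair_measure_countable1) (auto simp: valid_support_countable)
    then show ?thesis using 1 by (simp add: dominating_measure_def)
  next
    case 2
    \<comment> \<open>The coordinates are swapped to bring the countable factor to the
      front.\<close>
    then have "(\<lambda>z. H (snd z) (fst z)) \<in> borel_measurable (count_space SY \<Otimes>\<^sub>M \<nu>\<^sub>X)"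
      using validY curvature_measurable_fst
      by (intro measurable_pair_measure_countable1) (auto simp: valid_support_countable)
    then have "(\<lambda>z. H (snd z) (fst z)) \<in> borel_measurable (\<nu>\<^sub>Y \<Otimes>\<^sub>M \<nu>\<^sub>X)"
      using 2 by (simp add: dominating_measure_def)
    from measurable_compose[OF measurable_pair_swap' this] show ?thesis
      by (simp add: case_prod_beta)
  next
    case 3
    let ?U = "interior SX \<times> interior SY"
    have "(\<lambda>z. if z \<in> ?U then H (fst z) (snd z) else 0) \<in> borel_measurable borel"
      using curvature_joint_continuous(1)[OF 3]
      by (intro borel_measurable_continuous_on_if) (auto simp: open_Times borel_open)
    also have "(\<lambda>z. if z \<in> ?U then H (fst z) (snd z) else 0) = (\<lambda>z. H (fst z) (snd z))"
      using 3 by (auto simp: curvature_def support_interior_def admissible2_def fun_eq_iff)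
    finally have "(\<lambda>z. H (fst z) (snd z)) \<in> borel_measurable (borel :: (real \<times> real) measure)" .
    moreover have "(\<lambda>z. z) \<in> \<nu>\<^sub>X \<Otimes>\<^sub>M \<nu>\<^sub>Y \<rightarrow>\<^sub>M borel"
      unfolding borel_prod[symmetric]
      using measurable_compose[OF measurable_fst measurable_ident_dominating_measure[OF validX]]
        measurable_compose[OF measurable_snd measurable_ident_dominating_measure[OF validY]]
      by (intro measurable_pair[where f = "\<lambda>z. z"]) (auto simp: o_def)
    ultimately show ?thesis using measurable_compose by blast
  qed
qed

subsection \<open>Vanishing of the conditional curvature score\<close>

lemma measurable_pair_XY: "(\<lambda>\<omega>. (X \<omega>, Y \<omega>)) \<in> M \<rightarrow>\<^sub>M \<nu>\<^sub>X \<Otimes>\<^sub>M \<nu>\<^sub>Y"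
  using distributed_measurable[OF joint] .

lemma measurable_X: "X \<in> M \<rightarrow>\<^sub>M \<nu>\<^sub>X"
  using measurable_compose[OF measurable_pair_XY measurable_fst] by simp

lemma measurable_Y: "Y \<in> M \<rightarrow>\<^sub>M \<nu>\<^sub>Y"
  using measurable_compose[OF measurable_pair_XY measurable_snd] by simp

lemma pair_sigma_finite_dominating: "pair_sigma_finite \<nu>\<^sub>X \<nu>\<^sub>Y"
  using validX validY
  by (intro pair_sigma_finite.intro sigma_finite_dominating_measure)

lemma density_measurable [measurable]: "p \<in> borel_measurable (\<nu>\<^sub>X \<Otimes>\<^sub>M \<nu>\<^sub>Y)"
  using distributed_borel_measurable[OF joint] .

text \<open>The density is positive on the product of the interiors, which has full measure, so the
  joint law and the product of the dominating measures have the same null sets; Fubini splits these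
  into sections.\<close>

lemma AE_joint_iff:
  assumes P: "{z \<in> space (\<nu>\<^sub>X \<Otimes>\<^sub>M \<nu>\<^sub>Y). P (fst z) (snd z)} \<in> sets (\<nu>\<^sub>X \<Otimes>\<^sub>M \<nu>\<^sub>Y)"
  shows "(AE \<omega> in M. P (X \<omega>) (Y \<omega>)) \<longleftrightarrow>
    (AE x in \<nu>\<^sub>X. AE y in \<nu>\<^sub>Y. x \<in> I\<^sub>X \<longrightarrow> y \<in> I\<^sub>Y \<longrightarrow> P x y)"
proof -
  interpret pair_sigma_finite \<nu>\<^sub>X \<nu>\<^sub>Y by (rule pair_sigma_finite_dominating)
  have "(AE \<omega> in M. P (X \<omega>) (Y \<omega>)) \<longleftrightarrow>
      (AE z in distr M (\<nu>\<^sub>X \<Otimes>\<^sub>M \<nu>\<^sub>Y) (\<lambda>\<omega>. (X \<omega>, Y \<omega>)). P (fst z) (snd z))"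
    using AE_distr_iff[OF measurable_pair_XY P] by simp
  also have "\<dots> \<longleftrightarrow> (AE z in \<nu>\<^sub>X \<Otimes>\<^sub>M \<nu>\<^sub>Y. 0 < p (fst z, snd z) \<longrightarrow> P (fst z) (snd z))"
    unfolding distributed_distr_eq_density[OF joint] by (simp add: AE_density)
  also have "\<dots> \<longleftrightarrow> (AE x in \<nu>\<^sub>X. AE y in \<nu>\<^sub>Y. 0 < p (x, y) \<longrightarrow> P x y)"
  proof (rule AE_pair_iff[symmetric])
    have "{z \<in> space (\<nu>\<^sub>X \<Otimes>\<^sub>M \<nu>\<^sub>Y). \<not> 0 < p z} \<in> sets (\<nu>\<^sub>X \<Otimes>\<^sub>M \<nu>\<^sub>Y)" by measurable
    from sets.Un[OF this P] show "{z \<in> space (\<nu>\<^sub>X \<Otimes>\<^sub>M \<nu>\<^sub>Y). 0 < p (fst z, snd z) \<longrightarrow> P (fst z) (snd z)}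
        \<in> sets (\<nu>\<^sub>X \<Otimes>\<^sub>M \<nu>\<^sub>Y)"
      by (rule back_subst[of "\<lambda>S. S \<in> sets (\<nu>\<^sub>X \<Otimes>\<^sub>M \<nu>\<^sub>Y)"]) auto
  qed
  also have "\<dots> \<longleftrightarrow> (AE x in \<nu>\<^sub>X. AE y in \<nu>\<^sub>Y. x \<in> I\<^sub>X \<longrightarrow> y \<in> I\<^sub>Y \<longrightarrow> P x y)"
  proof
    assume "AE x in \<nu>\<^sub>X. AE y in \<nu>\<^sub>Y. 0 < p (x, y) \<longrightarrow> P x y"
    then show "AE x in \<nu>\<^sub>X. AE y in \<nu>\<^sub>Y. x \<in> I\<^sub>X \<longrightarrow> y \<in> I\<^sub>Y \<longrightarrow> P x y"
    proof eventually_elim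
      case (elim x)
      then show ?case by eventually_elim (use density_pos in blast)
    qed
  next
    assume "AE x in \<nu>\<^sub>X. AE y in \<nu>\<^sub>Y. x \<in> I\<^sub>X \<longrightarrow> y \<in> I\<^sub>Y \<longrightarrow> P x y"
    with AE_support_interior[OF validX]
    show "AE x in \<nu>\<^sub>X. AE y in \<nu>\<^sub>Y. 0 < p (x, y) \<longrightarrow> P x y"
    proof eventually_elim
      case (elim x)
      from elim(2) AE_support_interior[OF validY] show ?case
        by eventually_elim (use elim(1) in blast)
    qed
  qed
  finally show ?thesis .
qed

lemma admissible_sets: "{z \<in> space (\<nu>\<^sub>X \<Otimes>\<^sub>M \<nu>\<^sub>Y). snd z \<in> A\<^sub>Y} \<in> sets (\<nu>\<^sub>X \<Otimes>\<^sub>M \<nu>\<^sub>Y)"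
  using measurable_sets[OF measurable_compose[OF measurable_snd measurable_ident_dominating_measure[OF validY]]
      admissible2_measurable[OF validY]]
  by (simp add: vimage_def Int_def conj_commute)

text \<open>Makes conditioning on admissibility meaningful. Were the event null, Fubini would give
  an interior \<open>x\<close> for which almost no \<open>y\<close> is admissible, although the
  admissible set has positive measure.\<close>

lemma emeasure_admissible: "emeasure M {\<omega> \<in> space M. Y \<omega> \<in> A\<^sub>Y} \<noteq> 0"
proof
  assume 0: "emeasure M {\<omega> \<in> space M. Y \<omega> \<in> A\<^sub>Y} = 0"
  have "{\<omega> \<in> space M. Y \<omega> \<in> A\<^sub>Y} \<in> sets M"
    using measurable_sets[OF measurable_compose[OF measurable_Y measurable_ident_dominating_measure[OF validY]]
      admissible2_measurable[OF validY]]
    by (simp add: vimage_def Int_def conj_commute)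
  with 0 have "AE \<omega> in M. Y \<omega> \<notin> A\<^sub>Y" by (subst AE_iff_measurable) auto
  then have "AE x in \<nu>\<^sub>X. AE y in \<nu>\<^sub>Y. x \<in> I\<^sub>X \<longrightarrow> y \<in> I\<^sub>Y \<longrightarrow> y \<notin> A\<^sub>Y"
    using AE_joint_iff[of "\<lambda>x y. y \<notin> A\<^sub>Y"] sets.sets_Collect_neg[OF admissible_sets] by simp
  from AE_imp_ex_admissible2[OF validX this] obtain x where
    "x \<in> admissible2 kX SX" "AE y in \<nu>\<^sub>Y. x \<in> I\<^sub>X \<longrightarrow> y \<in> I\<^sub>Y \<longrightarrow> y \<notin> A\<^sub>Y" by blast
  with AE_imp_ex_admissible2[OF validY this(2)] show False
    using admissible2_subset_interior by blast
qed

lemma AE_admissible_prob_iff: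
  "(AE \<omega> in admissible_prob M kY SY Y. P \<omega>) \<longleftrightarrow> (AE \<omega> in M. Y \<omega> \<in> A\<^sub>Y \<longrightarrow> P \<omega>)"
proof -
  have "(AE \<omega> in admissible_prob M kY SY Y. P \<omega>) \<longleftrightarrow>
      (AE \<omega> in M. \<omega> \<in> {\<omega> \<in> space M. Y \<omega> \<in> A\<^sub>Y} \<longrightarrow> P \<omega>)"
    unfolding admissible_prob_def
    using emeasure_admissible by (intro AE_uniform_measure) (auto simp: less_top[symmetric])
  also have "\<dots> \<longleftrightarrow> (AE \<omega> in M. Y \<omega> \<in> A\<^sub>Y \<longrightarrow> P \<omega>)" by (rule AE_cong) auto
  finally show ?thesis .
qed

text \<open>A zero mean conditional variance means that the curvature is almost surely measurable
  for the sigma-algebra generated by \<open>Y\<close>, and by Doob-Dynkin such functions are exactly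
  the Borel functions of \<open>Y\<close>.\<close>

lemma score_eq_0_iff:
  assumes H2: "square_integrable (admissible_prob M kY SY Y) (\<lambda>\<omega>. H (X \<omega>) (Y \<omega>))"
  shows "cond_curvature_score M kX SX kY SY p X Y = 0 \<longleftrightarrow>
    (\<exists>g\<in>borel_measurable borel. AE \<omega> in M. Y \<omega> \<in> A\<^sub>Y \<longrightarrow> H (X \<omega>) (Y \<omega>) = g (Y \<omega>))"
proof -
  let ?Q = "admissible_prob M kY SY Y"
  let ?F = "vimage_algebra (space M) Y borel"
  have Q: "space ?Q = space M" "sets ?Q = sets M" by (simp_all add: admissible_prob_def)
  have Yb: "Y \<in> M \<rightarrow>\<^sub>M borel"
    using measurable_compose[OF measurable_Y measurable_ident_dominating_measure[OF validY]] by simp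
  have "subalgebra ?Q ?F"
    using measurable_sets[OF Yb] by (auto simp: subalgebra_def Q sets_vimage_algebra2)
  moreover have "prob_space ?Q"
    unfolding admissible_prob_def
    using emeasure_admissible by (intro prob_space_uniform_measure) auto
  ultimately have "cond_curvature_score M kX SX kY SY p X Y = 0 \<longleftrightarrow>
      (\<exists>f\<in>borel_measurable ?F. AE \<omega> in ?Q. H (X \<omega>) (Y \<omega>) = f \<omega>)"
    using H2 by (simp add: cond_curvature_score_def Let_def integral_cond_variance_eq_0_iff)
  also have "\<dots> \<longleftrightarrow> (\<exists>g\<in>borel_measurable borel. AE \<omega> in ?Q. H (X \<omega>) (Y \<omega>) = g (Y \<omega>))"
  proof (intro iffI; elim bexE)
    fix f assume f: "f \<in> borel_measurable ?F" and ae: "AE \<omega> in ?Q. H (X \<omega>) (Y \<omega>) = f \<omega>"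
    from Doob_Dynkin_real[OF _ f] obtain g :: "real \<Rightarrow> real"
      where g: "g \<in> borel_measurable borel" "\<And>\<omega>. \<omega> \<in> space M \<Longrightarrow> f \<omega> = g (Y \<omega>)" by auto
    have "AE \<omega> in ?Q. H (X \<omega>) (Y \<omega>) = g (Y \<omega>)"
      using ae AE_space by eventually_elim (simp add: g(2) Q)
    with g(1) show "\<exists>g\<in>borel_measurable borel. AE \<omega> in ?Q. H (X \<omega>) (Y \<omega>) = g (Y \<omega>)" by blast
  next
    fix g :: "real \<Rightarrow> real"
    assume g: "g \<in> borel_measurable borel" "AE \<omega> in ?Q. H (X \<omega>) (Y \<omega>) = g (Y \<omega>)"
    then show "\<exists>f\<in>borel_measurable ?F. AE \<omega> in ?Q. H (X \<omega>) (Y \<omega>) = f \<omega>"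
      by (intro bexI[of _ "\<lambda>\<omega>. g (Y \<omega>)"] measurable_compose[OF measurable_vimage_algebra1]) auto
  qed
  finally show ?thesis by (simp add: AE_admissible_prob_iff)
qed

text \<open>As \<open>g\<close> is merely Borel, continuity is used first in \<open>x\<close> for
  almost every fixed \<open>y\<close>, where \<open>g y\<close> is a constant. This eliminates
  \<open>g\<close>, and continuity of the curvature in \<open>y\<close> then reaches every
  admissible \<open>y\<close>.\<close>

lemma curvature_AE_fun_snd_imp_const:
  assumes g: "g \<in> borel_measurable borel"
    and ae: "AE \<omega> in M. Y \<omega> \<in> A\<^sub>Y \<longrightarrow> H (X \<omega>) (Y \<omega>) = g (Y \<omega>)"
    and x: "x \<in> I\<^sub>X" "x' \<in> I\<^sub>X" and y: "y \<in> A\<^sub>Y"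
  shows "H x y = H x' y"
proof -
  interpret pair_sigma_finite \<nu>\<^sub>X \<nu>\<^sub>Y by (rule pair_sigma_finite_dominating)
  let ?N = "\<nu>\<^sub>X \<Otimes>\<^sub>M \<nu>\<^sub>Y"
  have gY: "(\<lambda>z. g (snd z)) \<in> borel_measurable ?N"
    by (rule measurable_compose[OF measurable_compose[OF measurable_snd
        measurable_ident_dominating_measure[OF validY]] g])
  have meas: "{z \<in> space ?N. snd z \<in> A\<^sub>Y \<longrightarrow> H (fst z) (snd z) = g (snd z)} \<in> sets ?N"
    using sets.sets_Collect_imp[OF borel_measurable_eq[OF curvature_measurable gY] admissible_sets] .
  have "AE x in \<nu>\<^sub>X. AE y in \<nu>\<^sub>Y. x \<in> I\<^sub>X \<longrightarrow> y \<in> I\<^sub>Y \<longrightarrow> y \<in> A\<^sub>Y \<longrightarrow> H x y = g y"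
    using ae AE_joint_iff[OF meas] by simp
  then have "AE x in \<nu>\<^sub>X. AE y in \<nu>\<^sub>Y. y \<in> A\<^sub>Y \<longrightarrow> H x y = g y"
    using AE_support_interior[OF validX]
    by eventually_elim (use AE_support_interior[OF validY] admissible2_subset_interior in \<open>auto elim: eventually_mono\<close>)
  \<comment> \<open>Fubini exchanges the quantifiers, so that \<open>y\<close> is fixed before
    \<open>x\<close> varies.\<close>
  then have ae_y: "AE y in \<nu>\<^sub>Y. AE x in \<nu>\<^sub>X. y \<in> A\<^sub>Y \<longrightarrow> H x y = g y"
    using AE_commute[OF meas] by simp
  have "AE y in \<nu>\<^sub>Y. y \<in> A\<^sub>Y \<longrightarrow> H x y = H x' y"
    using ae_y
  proof eventually_elim
    case (elim y)
    show ?case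
    proof
      assume y: "y \<in> A\<^sub>Y"
      have *: "H x y = g y" if "x \<in> I\<^sub>X" for x
        using validX _ curvature_continuous_fst continuous_on_const that
      proof (rule AE_eq_imp_eq_on_interior[where g = "\<lambda>_. g y"])
        show "AE x in \<nu>\<^sub>X. x \<in> I\<^sub>X \<longrightarrow> H x y = g y" using elim y by (auto elim: eventually_mono)
      qed
      show "H x y = H x' y" using *[OF x(1)] *[OF x(2)] by simp
    qed
  qed
  \<comment> \<open>At inadmissible \<open>y\<close> both sides take the default value 0.\<close>
  then have "AE y in \<nu>\<^sub>Y. y \<in> I\<^sub>Y \<longrightarrow> H x y = H x' y"
    by eventually_elim (auto simp: curvature_def)
  from AE_eq_imp_eq_on_interior[OF validY this curvature_continuous_snd curvature_continuous_snd]
  show ?thesis using y admissible2_subset_interior by blast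
qed

subsection \<open>Densities of exponential form\<close>

text \<open>The denominator of \<open>cond_density\<close>, which is at the same time the density of
  \<open>X\<close>.\<close>

definition marginal :: "real \<Rightarrow> ennreal" where
  "marginal x = (\<integral>\<^sup>+y. p (x, y) \<partial>\<nu>\<^sub>Y)"

lemma distributed_marginal: "distributed M \<nu>\<^sub>X X marginal"
  unfolding marginal_def
  using distr_marginal1[OF sigma_finite_dominating_measure[OF validX]
      sigma_finite_dominating_measure[OF validY] joint] .

text \<open>A density is almost surely positive under its own law, and it is almost everywhere
  finite because it integrates to 1. The quotient defining the conditional density is therefore
  genuine.\<close>

lemma AE_law_X: "AE x in distr M \<nu>\<^sub>X X. x \<in> I\<^sub>X \<and> 0 < marginal x \<and> marginal x < \<infinity>"
proof -
  have m: "marginal \<in> borel_measurable \<nu>\<^sub>X"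
    using distributed_borel_measurable[OF distributed_marginal] .
  have eq: "distr M \<nu>\<^sub>X X = density \<nu>\<^sub>X marginal"
    using distributed_distr_eq_density[OF distributed_marginal] .
  have "emeasure (density \<nu>\<^sub>X marginal) (space \<nu>\<^sub>X) = 1"
    using prob_space.emeasure_space_1[OF prob_space_distr[OF measurable_X]] by (simp add: eq)
  then have "(\<integral>\<^sup>+x. marginal x \<partial>\<nu>\<^sub>X) = 1"
    by (simp only: emeasure_density[OF m sets.top] nn_set_integral_space)
  then have "AE x in \<nu>\<^sub>X. marginal x \<noteq> \<infinity>"
    using m by (intro nn_integral_PInf_AE) auto
  with AE_support_interior[OF validX]
  have "AE x in \<nu>\<^sub>X. 0 < marginal x \<longrightarrow> x \<in> I\<^sub>X \<and> 0 < marginal x \<and> marginal x < \<infinity>"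
    by eventually_elim (auto simp: less_top)
  then show ?thesis unfolding eq AE_density[OF m] .
qed

text \<open>The slope of the affine log ratio to a reference point \<open>x\<^sub>0\<close> is the
  natural parameter \<open>\<eta> x\<close>; its intercept \<open>\<alpha> x\<close> cancels on
  normalisation.\<close>

lemma curvature_const_imp_glm:
  assumes const: "\<And>x x' y. x \<in> I\<^sub>X \<Longrightarrow> x' \<in> I\<^sub>X \<Longrightarrow> y \<in> A\<^sub>Y \<Longrightarrow> H x y = H x' y"
  shows "glm_conditional_form M kX SX kY SY p X"
proof -
  obtain x\<^sub>0 where x0: "x\<^sub>0 \<in> I\<^sub>X"
    using admissible2_nonempty[OF validX] admissible2_subset_interior by blast
  have "\<exists>\<alpha> \<eta>. \<forall>y\<in>I\<^sub>Y. L x y - L x\<^sub>0 y = \<alpha> + \<eta> * y" if x: "x \<in> I\<^sub>X" for x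
  proof (rule diff_op2_zero_imp_affine[OF validY])
    show "twice_diff kY SY (\<lambda>y. L x y - L x\<^sub>0 y)"
      by (rule twice_diff_lincomb[OF twice_diff_log_dens[OF x] twice_diff_log_dens[OF x0], where c = "-1"])
        simp
    show "diff_op2 kY (\<lambda>y. L x y - L x\<^sub>0 y) y = 0" if y: "y \<in> A\<^sub>Y" for y
    proof -
      have "diff_op2 kY (\<lambda>y. L x y - L x\<^sub>0 y) y = diff_op2 kY (L x) y + (-1) * diff_op2 kY (L x\<^sub>0) y"
        by (rule diff_op2_lincomb[OF twice_diff_log_dens[OF x] twice_diff_log_dens[OF x0] _ y]) simp
      then show ?thesis using const[OF x x0 y] curvature_eq[OF x y] curvature_eq[OF x0 y] by simp
    qed
  qed
  then obtain \<alpha> \<eta> where \<alpha>\<eta>: "\<And>x y. x \<in> I\<^sub>X \<Longrightarrow> y \<in> I\<^sub>Y \<Longrightarrow> L x y - L x\<^sub>0 y = \<alpha> x + \<eta> x * y"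
    by metis
  define b where "b y = exp (L x\<^sub>0 y)" for y
  define Z where "Z x = (\<integral>\<^sup>+u. ennreal (b u * exp (u * \<eta> x)) \<partial>\<nu>\<^sub>Y)" for x
  have p_eq: "p (x, y) = ennreal (exp (\<alpha> x)) * ennreal (b y * exp (y * \<eta> x))"
    if "x \<in> I\<^sub>X" "y \<in> I\<^sub>Y" for x y
  proof -
    have "L x y = \<alpha> x + (L x\<^sub>0 y + y * \<eta> x)"
      using \<alpha>\<eta>[OF that] by (simp add: algebra_simps)
    then show ?thesis
      by (simp add: density_eq_exp[OF that] b_def exp_add ennreal_mult)
  qed
  have [measurable]: "(\<lambda>y. p (x\<^sub>0, y)) \<in> borel_measurable \<nu>\<^sub>Y"
    using x0 support_interior_subset
    by (intro measurable_compose[OF measurable_Pair1' density_measurable]) auto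
  have [measurable]: "(\<lambda>y. y) \<in> borel_measurable \<nu>\<^sub>Y"
    by (rule measurable_ident_dominating_measure[OF validY])
  have marginal_eq: "marginal x = ennreal (exp (\<alpha> x)) * Z x" if "x \<in> I\<^sub>X" for x
  proof -
    \<comment> \<open>The factorisation \<open>p_eq\<close> is available only on the interior of the
      support of \<open>Y\<close>, but the remaining points are null.\<close>
    have "marginal x = (\<integral>\<^sup>+y. ennreal (exp (\<alpha> x)) * ennreal (b y * exp (y * \<eta> x)) \<partial>\<nu>\<^sub>Y)"
      unfolding marginal_def using AE_support_interior[OF validY]
      by (intro nn_integral_cong_AE) (auto elim!: eventually_mono simp: p_eq that)
    also have "\<dots> = ennreal (exp (\<alpha> x)) * Z x"
      unfolding Z_def b_def log_dens_def by (intro nn_integral_cmult) measurable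
    finally show ?thesis .
  qed
  have "AE x in distr M \<nu>\<^sub>X X. \<bar>log_partition \<nu>\<^sub>Y b (\<eta> x)\<bar> \<noteq> \<infinity> \<and>
    (\<forall>y\<in>I\<^sub>Y. cond_density \<nu>\<^sub>Y p x y =
      ennreal (b y * exp (y * \<eta> x - real_of_ereal (log_partition \<nu>\<^sub>Y b (\<eta> x)))))"
    using AE_law_X
  proof eventually_elim
    case (elim x)
    then have Z: "0 < Z x" "Z x < \<infinity>"
      using marginal_eq[of x] by (auto simp: ennreal_mult_less_top ennreal_zero_less_mult_iff)
    define z where "z = enn2real (Z x)"
    have z: "Z x = ennreal z" "0 < z" using Z by (auto simp: z_def enn2real_positive_iff)
    \<comment> \<open>As \<open>Z x\<close> is positive and finite, neither infinite branch of
      \<open>ln_ereal\<close> is taken.\<close>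
    have lp: "log_partition \<nu>\<^sub>Y b (\<eta> x) = ereal (ln z)"
      using Z by (auto simp: log_partition_def Z_def[symmetric] ln_ereal_def z_def)
    have "cond_density \<nu>\<^sub>Y p x y = ennreal (b y * exp (y * \<eta> x - ln z))" if y: "y \<in> I\<^sub>Y" for y
    proof -
      have "cond_density \<nu>\<^sub>Y p x y =
          ennreal (exp (\<alpha> x) * (b y * exp (y * \<eta> x))) / ennreal (exp (\<alpha> x) * z)"
        using elim y z
        by (simp add: cond_density_def marginal_def[symmetric] marginal_eq p_eq ennreal_mult b_def)
      also have "\<dots> = ennreal (exp (\<alpha> x) * (b y * exp (y * \<eta> x)) / (exp (\<alpha> x) * z))"
        using z by (intro divide_ennreal) (auto simp: b_def)
      also have "exp (\<alpha> x) * (b y * exp (y * \<eta> x)) / (exp (\<alpha> x) * z) = b y * exp (y * \<eta> x - ln z)"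
        using z by (simp add: exp_diff)
      finally show ?thesis .
    qed
    then show ?case by (simp add: lp)
  qed
  then show ?thesis
    unfolding glm_conditional_form_def Let_def
    by (intro exI[of _ b] exI[of _ \<eta>]) (auto simp: b_def)
qed

section \<open>From the exponential form back to the curvature\<close>

lemma glm_imp_log_dens:
  assumes b: "\<And>y. y \<in> I\<^sub>Y \<Longrightarrow> 0 < b y" and x: "x \<in> I\<^sub>X" "0 < marginal x" "marginal x < \<infinity>"
    and glm: "\<And>y. y \<in> I\<^sub>Y \<Longrightarrow> cond_density \<nu>\<^sub>Y p x y = ennreal (b y * exp (y * t - a))"
    and y: "y \<in> I\<^sub>Y"
  shows "L x y = ln (b y) + ((ln (enn2real (marginal x)) - a) + t * y)"
proof -
  define m where "m = enn2real (marginal x)"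
  have m: "marginal x = ennreal m" "0 < m" using x by (auto simp: m_def enn2real_positive_iff)
  have "ennreal (exp (L x y) / m) = cond_density \<nu>\<^sub>Y p x y"
    using m by (simp add: cond_density_def marginal_def[symmetric] density_eq_exp[OF x(1) y] divide_ennreal)
  also have "\<dots> = ennreal (b y * exp (y * t - a))" by (rule glm[OF y])
  finally have "exp (L x y) / m = b y * exp (y * t - a)"
    using m b[OF y] by (subst (asm) ennreal_inj) auto
  then have "exp (L x y) = m * (b y * exp (y * t - a))" using m by (simp add: field_simps)
  then have "L x y = ln (m * (b y * exp (y * t - a)))" by (metis ln_exp)
  also have "\<dots> = ln m + (ln (b y) + (y * t - a))" using m b[OF y] by (simp add: ln_mult)
  finally show ?thesis by (simp add: m_def algebra_simps)
qed

text \<open>No smoothness of \<open>b\<close> is given, so \<open>ln b\<close> is not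
  differentiated. Sections of the log density are compared with the section at one good point
  \<open>x\<^sub>1\<close>: the terms \<open>ln (b y)\<close> cancel and an affine function of
  \<open>y\<close> is left, which the operator kills.\<close>

lemma glm_imp_curvature_AE_fun_snd:
  assumes "glm_conditional_form M kX SX kY SY p X"
  shows "\<exists>g\<in>borel_measurable borel. AE \<omega> in M. Y \<omega> \<in> A\<^sub>Y \<longrightarrow> H (X \<omega>) (Y \<omega>) = g (Y \<omega>)"
proof -
  obtain b \<eta> where b: "\<And>y. y \<in> I\<^sub>Y \<Longrightarrow> 0 < b y"
    and glm: "AE x in distr M \<nu>\<^sub>X X. \<bar>log_partition \<nu>\<^sub>Y b (\<eta> x)\<bar> \<noteq> \<infinity> \<and>
      (\<forall>y\<in>I\<^sub>Y. cond_density \<nu>\<^sub>Y p x y =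
        ennreal (b y * exp (y * \<eta> x - real_of_ereal (log_partition \<nu>\<^sub>Y b (\<eta> x)))))"
    using assms unfolding glm_conditional_form_def Let_def by blast
  have ae: "AE x in distr M \<nu>\<^sub>X X. x \<in> I\<^sub>X \<and> (\<exists>a c. \<forall>y\<in>I\<^sub>Y. L x y = ln (b y) + (a + c * y))"
    using glm AE_law_X
  proof eventually_elim
    case (elim x)
    have "\<forall>y\<in>I\<^sub>Y. L x y = ln (b y) +
        ((ln (enn2real (marginal x)) - real_of_ereal (log_partition \<nu>\<^sub>Y b (\<eta> x))) + \<eta> x * y)"
      using elim by (intro ballI glm_imp_log_dens b) auto
    then show ?case using elim by blast
  qed
  interpret PX: prob_space "distr M \<nu>\<^sub>X X" by (rule prob_space_distr[OF measurable_X])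
  \<comment> \<open>The law of \<open>X\<close> is a probability measure, so an almost sure property
    holds at some point.\<close>
  obtain x\<^sub>1 a\<^sub>1 c\<^sub>1 where x1: "x\<^sub>1 \<in> I\<^sub>X"
    and L1: "\<And>y. y \<in> I\<^sub>Y \<Longrightarrow> L x\<^sub>1 y = ln (b y) + (a\<^sub>1 + c\<^sub>1 * y)"
    using eventually_happens'[OF PX.ae_filter_bot ae] by blast
  have "H x y = H x\<^sub>1 y"
    if x: "x \<in> I\<^sub>X" and L: "\<And>y. y \<in> I\<^sub>Y \<Longrightarrow> L x y = ln (b y) + (a + c * y)" and y: "y \<in> A\<^sub>Y"
    for x y a c
  proof -
    have "diff_op2 kY (L x) y = diff_op2 kY (L x\<^sub>1) y + 1 * diff_op2 kY (\<lambda>y. (a - a\<^sub>1) + (c - c\<^sub>1) * y) y"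
      by (rule diff_op2_lincomb[OF twice_diff_log_dens[OF x1] twice_diff_affine _ y])
        (simp add: L L1 algebra_simps)
    then show ?thesis using curvature_eq[OF x y] curvature_eq[OF x1 y] by (simp add: diff_op2_affine)
  qed
  note H_eq = this
  have "AE x in distr M \<nu>\<^sub>X X. \<forall>y\<in>A\<^sub>Y. H x y = H x\<^sub>1 y"
    using ae by eventually_elim (use H_eq in blast)
  then have "AE \<omega> in M. \<forall>y\<in>A\<^sub>Y. H (X \<omega>) y = H x\<^sub>1 y"
    by (rule AE_distrD[OF measurable_X])
  then have "AE \<omega> in M. Y \<omega> \<in> A\<^sub>Y \<longrightarrow> H (X \<omega>) (Y \<omega>) = H x\<^sub>1 (Y \<omega>)"
    by eventually_elim blast
  moreover have "H x\<^sub>1 \<in> borel_measurable borel"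
  proof -
    have "H x\<^sub>1 \<in> borel_measurable (restrict_space borel SY)"
      using curvature_measurable_snd sets_dominating_measure[OF validY]
      by (simp cong: measurable_cong_sets)
    \<comment> \<open>The curvature is 0 outside the support of \<open>Y\<close>, so measurability
      on the trace extends to the whole line.\<close>
    then have "(\<lambda>y. indicator SY y *\<^sub>R H x\<^sub>1 y) \<in> borel_measurable borel"
      using valid_support_measurable[OF validY]
      by (subst (asm) borel_measurable_restrict_space_iff) auto
    also have "(\<lambda>y. indicator SY y *\<^sub>R H x\<^sub>1 y) = H x\<^sub>1"
      using admissible2_subset_interior support_interior_subset
      by (fastforce simp: curvature_def indicator_def)
    finally show ?thesis .
  qed
  ultimately show ?thesis by blast
qed

end

theorem theorem5:
  fixes M :: "'a measure" and X Y :: "'a \<Rightarrow> real"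
    and kX kY :: var_kind and SX SY :: "real set"
    and p :: "real \<times> real \<Rightarrow> ennreal"
  assumes "prob_space M"
    and "valid_support kX SX" and "valid_support kY SY"
    and "distributed M (dominating_measure kX SX \<Otimes>\<^sub>M dominating_measure kY SY)
           (\<lambda>\<omega>. (X \<omega>, Y \<omega>)) p"
    and "regular_density kX SX kY SY p"
    and "square_integrable (admissible_prob M kY SY Y)
           (\<lambda>\<omega>. curvature kX SX kY SY p (X \<omega>) (Y \<omega>))"
  shows "cond_curvature_score M kX SX kY SY p X Y = 0 \<longleftrightarrow>
         glm_conditional_form M kX SX kY SY p X"
proof -
  interpret prob_space M by fact
  interpret regular_pair M kX kY SX SY p X Y by unfold_locales fact+
  show ?thesis
    unfolding score_eq_0_iff[OF assms(6)]
    using curvature_const_imp_glm curvature_AE_fun_snd_imp_const glm_imp_curvature_AE_fun_snd by blast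
qed

end
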